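(* Let $(X,\|\cdot\|)$ be a real Banach space and let $T:X\to X$ be an enriched $\mathcal{A}$-contraction. Then the fixed point problem concerning $T$ is well-posed.
   Context: Write $\mathbb{R}_+=[0,\infty)$. Let $\mathcal{A}$ be the collection of all mappings $f:\mathbb{R}_+^3\to\mathbb{R}$ satisfying: ($\mathcal{A}_1$) $f$ is continuous; ($\mathcal{A}_2$) there exists $k\in[0,1)$ such that for all $r,s\in\mathbb{R}_+$: if $r\le f(s,r,s)$ or $r\le f(r,s,s)$, then $r\le ks$; ($\mathcal{A}_3$) for all $\lambda>0$ and all $r,s,t\in\mathbb{R}_+$, $\lambda f(r,s,t)\le f(\lambda r,\lambda s,\lambda t)$. Let $(X,\|\cdot\|)$ be a real Banach space. A mapping $T:X\to X$ is called an enriched $\mathcal{A}$-contraction if there exist $b\in[0,\infty)$ and $f\in\mathcal{A}$ such that $$\|b(u-v)+Tu-Tv\|\le f\big((b+1)\|u-v\|,\ \|u-Tu\|,\ \|v-Tv\|\big)$$ for all $u,v\in X$ with $u\ne v$. For a self-map $T$ of a metric space $(X,d)$, the fixed point problem concerning $T$ is called well-posed if (i) $T$ has a unique fixed point $p\in X$; and (ii) for any sequence $\{u_n\}$ in $X$ with $\lim_{n\to\infty}d(u_n,Tu_n)=0$, one has $\lim_{n\to\infty}d(u_n,p)=0$. Here $d(u,v)=\|u-v\|$. *)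

theory Defs
  imports "HOL-Analysis.Analysis"
begin

text \<open>Maps from the nonnegative octant to the reals are represented by curried total functions;
  only their values at nonnegative arguments are constrained, and only those values matter.\<close>

definition class_A :: "(real \<Rightarrow> real \<Rightarrow> real \<Rightarrow> real) set" where
  "class_A = {f.
     continuous_on ({0..} \<times> {0..} \<times> {0..}) (\<lambda>(r, s, t). f r s t) \<and>
     (\<exists>k\<in>{0..<1}. \<forall>r\<ge>0. \<forall>s\<ge>0. r \<le> f s r s \<or> r \<le> f r s s \<longrightarrow> r \<le> k * s) \<and>
     (\<forall>c>0. \<forall>r\<ge>0. \<forall>s\<ge>0. \<forall>t\<ge>0. c * f r s t \<le> f (c * r) (c * s) (c * t))}"

definition enriched_A_contraction :: "('a::real_normed_vector \<Rightarrow> 'a) \<Rightarrow> bool" where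
  "enriched_A_contraction T \<longleftrightarrow>
     (\<exists>b\<ge>0. \<exists>f\<in>class_A. \<forall>u v. u \<noteq> v \<longrightarrow>
        norm (b *\<^sub>R (u - v) + T u - T v)
          \<le> f ((b + 1) * norm (u - v)) (norm (u - T u)) (norm (v - T v)))"

definition well_posed_fixed_point_problem :: "('a::metric_space \<Rightarrow> 'a) \<Rightarrow> bool" where
  "well_posed_fixed_point_problem T \<longleftrightarrow>
     (\<exists>!p. T p = p) \<and>
     (\<forall>u :: nat \<Rightarrow> 'a. (\<lambda>n. dist (u n) (T (u n))) \<longlonglongrightarrow> 0 \<longrightarrow>
        (\<lambda>n. dist (u n) (THE p. T p = p)) \<longlonglongrightarrow> 0)"

end

theory Submission
  imports Defs
begin

text \<open>
  Averaging removes the enrichment. With \<open>S u = (b u + T u) / (b + 1)\<close> the hypothesis on \<open>T\<close>,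
  multiplied by \<open>1 / (b + 1)\<close> and combined with the scaling property of \<open>f\<close>, becomes
  \<open>d (S u) (S v) \<le> f (d u v) (d u (S u)) (d v (S v))\<close> for \<open>u \<noteq> v\<close>. Moreover
  \<open>d u (S u) = d u (T u) / (b + 1)\<close>, so \<open>S\<close> and \<open>T\<close> have the same fixed points and the same
  approximate fixed point sequences, and it suffices to treat \<open>S\<close> on a complete metric space.

  The heart of the matter is an a priori estimate: there is a constant \<open>C\<close> with
  \<open>d u v \<le> C (d u (S u) + d v (S v))\<close> for all \<open>u\<close>, \<open>v\<close>. By the triangle inequality the distance
  \<open>d\<close> satisfies \<open>d \<le> x + y + f d x y\<close>, where \<open>x\<close> and \<open>y\<close> are the two residuals. If these were
  small compared with \<open>d\<close>, division by \<open>d\<close> and continuity of \<open>f\<close> at \<open>(1, 0, 0)\<close>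
  would contradict \<open>f 1 0 0 < 1\<close>, which is the implication \<open>r \<le> f r 0 0 \<Longrightarrow> r \<le> 0\<close> at \<open>r = 1\<close>.

  This one estimate shows that fixed points are unique, that approximate fixed point sequences
  converge to the fixed point, and that they are Cauchy even before a fixed point is known.
  Existence then needs only some approximate fixed point sequence, namely the Picard iterates,
  whose residuals shrink by the factor \<open>k\<close> at each step, and the fact that its limit is fixed.
\<close>

definition A_contraction_wrt :: "(real \<Rightarrow> real \<Rightarrow> real \<Rightarrow> real) \<Rightarrow> ('a::metric_space \<Rightarrow> 'a) \<Rightarrow> bool" where
  "A_contraction_wrt f S \<longleftrightarrow>
     (\<forall>u v. u \<noteq> v \<longrightarrow> dist (S u) (S v) \<le> f (dist u v) (dist u (S u)) (dist v (S v)))"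

lemma class_A_scale:
  assumes "f \<in> class_A" "c > 0" "r \<ge> 0" "s \<ge> 0" "t \<ge> 0"
  shows "c * f r s t \<le> f (c * r) (c * s) (c * t)"
  using assms by (auto simp: class_A_def)

lemma class_A_contraction_constant:
  assumes "f \<in> class_A"
  obtains k where "0 \<le> k" "k < 1"
    "\<And>r s. \<lbrakk>r \<ge> 0; s \<ge> 0; r \<le> f s r s\<rbrakk> \<Longrightarrow> r \<le> k * s"
    "\<And>r s. \<lbrakk>r \<ge> 0; s \<ge> 0; r \<le> f r s s\<rbrakk> \<Longrightarrow> r \<le> k * s"
proof -
  from assms obtain k where "k \<in> {0..<1}"
    and "\<forall>r\<ge>0. \<forall>s\<ge>0. r \<le> f s r s \<or> r \<le> f r s s \<longrightarrow> r \<le> k * s"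
    by (auto simp: class_A_def)
  then show thesis
    by (intro that[of k]) auto
qed

lemma class_A_tendsto:
  assumes f: "f \<in> class_A"
    and lim: "(x \<longlongrightarrow> r) F" "(y \<longlongrightarrow> s) F" "(z \<longlongrightarrow> t) F"
    and nonneg: "\<And>i. x i \<ge> 0" "\<And>i. y i \<ge> 0" "\<And>i. z i \<ge> 0" "r \<ge> 0" "s \<ge> 0" "t \<ge> 0"
  shows "((\<lambda>i. f (x i) (y i) (z i)) \<longlongrightarrow> f r s t) F"
proof -
  have cont: "continuous_on ({0..} \<times> {0..} \<times> {0..}) (\<lambda>(r, s, t). f r s t)"
    using f by (simp add: class_A_def)
  have "((\<lambda>i. (x i, y i, z i)) \<longlongrightarrow> (r, s, t)) F"
    by (intro tendsto_Pair lim)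
  from continuous_on_tendsto_compose[OF cont this] show ?thesis
    using nonneg by simp
qed

text \<open>
  The inequality \<open>d \<le> x + y + f d x y\<close> bounds \<open>d\<close> linearly because it scales:
  a violation by a sequence of constants \<open>C = n + 1\<close> can be normalised to \<open>d = 1\<close>, forces \<open>x\<close> and
  \<open>y\<close> to tend to \<open>0\<close>, and so yields \<open>1 \<le> f 1 0 0\<close> in the limit.
\<close>

lemma class_A_linear_bound:
  assumes f: "f \<in> class_A"
  obtains C where "\<And>d x y. \<lbrakk>d \<ge> 0; x \<ge> 0; y \<ge> 0; d \<le> x + y + f d x y\<rbrakk> \<Longrightarrow> d \<le> C * (x + y)"
proof -
  have "\<exists>C. \<forall>d\<ge>0. \<forall>x\<ge>0. \<forall>y\<ge>0. d \<le> x + y + f d x y \<longrightarrow> d \<le> C * (x + y)"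
  proof (rule ccontr)
    assume "\<not> ?thesis"
    then have "\<forall>n::nat. \<exists>d x y. d \<ge> 0 \<and> x \<ge> 0 \<and> y \<ge> 0 \<and> d \<le> x + y + f d x y
                 \<and> real (Suc n) * (x + y) < d"
      by (metis not_le)
    then obtain d x y where d: "\<And>n::nat. d n \<ge> 0" and x: "\<And>n. x n \<ge> 0" and y: "\<And>n. y n \<ge> 0"
      and le: "\<And>n. d n \<le> x n + y n + f (d n) (x n) (y n)"
      and small: "\<And>n. real (Suc n) * (x n + y n) < d n"
      by metis
    have pos: "d n > 0" for n
      using small[of n] x[of n] y[of n] by (smt (verit) mult_nonneg_nonneg of_nat_0_le_iff)
    have ratio: "x n / d n + y n / d n \<le> inverse (real (Suc n))" for n
      using small[of n] pos[of n] by (simp add: field_simps)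
    have lim_x: "(\<lambda>n. x n / d n) \<longlonglongrightarrow> 0" and lim_y: "(\<lambda>n. y n / d n) \<longlonglongrightarrow> 0"
    proof -
      have "x n / d n \<le> inverse (real (Suc n))" "y n / d n \<le> inverse (real (Suc n))" for n
        using ratio[of n] divide_nonneg_pos[OF x[of n] pos[of n]]
          divide_nonneg_pos[OF y[of n] pos[of n]] by linarith+
      then show "(\<lambda>n. x n / d n) \<longlonglongrightarrow> 0" "(\<lambda>n. y n / d n) \<longlonglongrightarrow> 0"
        using x y pos
        by (auto intro!: tendsto_sandwich[OF _ _ tendsto_const LIMSEQ_inverse_real_of_nat]
            always_eventually simp: less_imp_le)
    qed
    have normalised: "1 \<le> x n / d n + y n / d n + f 1 (x n / d n) (y n / d n)" for n
    proof -
      have "1 \<le> x n / d n + y n / d n + inverse (d n) * f (d n) (x n) (y n)"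
        using mult_left_mono[OF le[of n], of "inverse (d n)"] pos[of n]
        by (simp add: divide_inverse algebra_simps)
      moreover have "inverse (d n) * f (d n) (x n) (y n) \<le> f 1 (x n / d n) (y n / d n)"
        using class_A_scale[OF f, of "inverse (d n)" "d n" "x n" "y n"] pos[of n] x[of n] y[of n]
        by (simp add: divide_inverse mult.commute)
      ultimately show ?thesis by linarith
    qed
    have "(\<lambda>n. x n / d n + y n / d n + f 1 (x n / d n) (y n / d n)) \<longlonglongrightarrow> 0 + 0 + f 1 0 0"
      using x y pos
      by (intro tendsto_add class_A_tendsto[OF f] tendsto_const lim_x lim_y)
        (auto simp: less_imp_le)
    then have "1 \<le> f 1 0 0"
      using LIMSEQ_le_const normalised by fastforce
    moreover obtain k where "\<And>r s. \<lbrakk>r \<ge> 0; s \<ge> 0; r \<le> f r s s\<rbrakk> \<Longrightarrow> r \<le> k * s"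
      using class_A_contraction_constant[OF f] by metis
    from this[of 1 0] have "\<not> 1 \<le> f 1 0 0" by auto
    ultimately show False by blast
  qed
  then show thesis using that by blast
qed

lemma A_contraction_dist_le_residuals:
  assumes f: "f \<in> class_A" and S: "A_contraction_wrt f S"
  obtains C where "\<And>u v. dist u v \<le> C * (dist u (S u) + dist v (S v))"
proof -
  obtain C where C: "\<And>d x y. \<lbrakk>d \<ge> 0; x \<ge> 0; y \<ge> 0; d \<le> x + y + f d x y\<rbrakk> \<Longrightarrow> d \<le> C * (x + y)"
    using class_A_linear_bound[OF f] by metis
  \<comment> \<open>The case \<open>u = v\<close> needs a nonnegative constant.\<close>
  have "dist u v \<le> max 0 C * (dist u (S u) + dist v (S v))" for u v
  proof (cases "u = v")
    case False
    have "dist u v \<le> dist u (S u) + dist (S u) (S v) + dist (S v) v"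
      using dist_triangle[of u v "S u"] dist_triangle[of "S u" v "S v"] by linarith
    also have "\<dots> \<le> dist u (S u) + dist v (S v) + f (dist u v) (dist u (S u)) (dist v (S v))"
      using S False by (auto simp: A_contraction_wrt_def dist_commute)
    finally have "dist u v \<le> C * (dist u (S u) + dist v (S v))"
      by (intro C) auto
    also have "\<dots> \<le> max 0 C * (dist u (S u) + dist v (S v))"
      by (intro mult_right_mono) auto
    finally show ?thesis .
  qed simp
  then show thesis by (rule that)
qed

text \<open>
  The two points \<open>S u\<close> and \<open>u\<close> enter in this order so that the old residual \<open>s\<close> and the new one
  \<open>r\<close> appear as \<open>f s r s\<close>; the opposite order would give \<open>f s s r\<close>, about which the contraction
  constant says nothing.
\<close>

lemma A_contraction_residual_tendsto_0:
  assumes f: "f \<in> class_A" and S: "A_contraction_wrt f S"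
  shows "(\<lambda>n. dist ((S ^^ n) u) (S ((S ^^ n) u))) \<longlonglongrightarrow> 0"
proof -
  obtain k where k: "0 \<le> k" "k < 1"
    and contract: "\<And>r s. \<lbrakk>r \<ge> 0; s \<ge> 0; r \<le> f s r s\<rbrakk> \<Longrightarrow> r \<le> k * s"
    using class_A_contraction_constant[OF f] by metis
  have step: "dist (S v) (S (S v)) \<le> k * dist v (S v)" for v
  proof (cases "S v = v")
    case False
    have "dist (S (S v)) (S v) \<le> f (dist (S v) v) (dist (S v) (S (S v))) (dist v (S v))"
      using S False by (simp add: A_contraction_wrt_def)
    then show ?thesis
      by (intro contract) (simp_all add: dist_commute)
  qed simp
  have geometric: "dist ((S ^^ n) u) (S ((S ^^ n) u)) \<le> k ^ n * dist u (S u)" for n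
  proof (induction n)
    case (Suc n)
    then show ?case
      using step[of "(S ^^ n) u"] mult_left_mono[OF Suc k(1)] by (simp add: mult.assoc)
  qed simp
  have "(\<lambda>n. k ^ n * dist u (S u)) \<longlonglongrightarrow> 0"
    using k by (intro tendsto_mult_left_zero LIMSEQ_realpow_zero) auto
  from tendsto_sandwich[OF _ _ tendsto_const this] show ?thesis
    using geometric by simp
qed

text \<open>
  The map \<open>S\<close> may be discontinuous, so the limit is taken in the contraction inequality instead.
  Were \<open>r = d p (S p)\<close> positive, comparing \<open>p\<close> with \<open>w n\<close> would give \<open>r \<le> f 0 r 0\<close> in the limit,
  hence \<open>r \<le> k * 0\<close>. The comparison needs
  \<open>w n \<noteq> p\<close>, which holds eventually since \<open>w n = p\<close> makes the residual of \<open>w n\<close> equal to \<open>r\<close>.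
\<close>

lemma A_contraction_fixed_limit:
  assumes f: "f \<in> class_A" and S: "A_contraction_wrt f S"
    and res: "(\<lambda>n. dist (w n) (S (w n))) \<longlonglongrightarrow> 0" and lim: "w \<longlonglongrightarrow> p"
  shows "S p = p"
proof (rule ccontr)
  assume "S p \<noteq> p"
  then have r: "dist p (S p) > 0" by simp
  obtain k where contract: "\<And>r s. \<lbrakk>r \<ge> 0; s \<ge> 0; r \<le> f s r s\<rbrakk> \<Longrightarrow> r \<le> k * s"
    using class_A_contraction_constant[OF f] by metis
  have "\<forall>\<^sub>F n in sequentially. dist (w n) (S (w n)) < dist p (S p)"
    using res r by (rule order_tendstoD)
  then have ev: "\<forall>\<^sub>F n in sequentially. dist p (S p) \<le> dist p (w n) + dist (w n) (S (w n))
      + f (dist p (w n)) (dist p (S p)) (dist (w n) (S (w n)))"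
  proof eventually_elim
    case (elim n)
    then have "p \<noteq> w n" by auto
    then have "dist (S p) (S (w n)) \<le> f (dist p (w n)) (dist p (S p)) (dist (w n) (S (w n)))"
      using S by (simp add: A_contraction_wrt_def)
    then show ?case
      using dist_triangle[of p "S p" "w n"] dist_triangle[of "w n" "S p" "S (w n)"]
      by (simp add: dist_commute)
  qed
  have dist_lim: "(\<lambda>n. dist p (w n)) \<longlonglongrightarrow> 0"
    using tendsto_dist[OF tendsto_const[of p] lim] by simp
  have "(\<lambda>n. dist p (w n) + dist (w n) (S (w n))
      + f (dist p (w n)) (dist p (S p)) (dist (w n) (S (w n)))) \<longlonglongrightarrow> 0 + 0 + f 0 (dist p (S p)) 0"
    by (intro tendsto_add class_A_tendsto[OF f] tendsto_const dist_lim res) auto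
  from tendsto_lowerbound[OF this ev] have "dist p (S p) \<le> f 0 (dist p (S p)) 0"
    by simp
  from contract[OF _ _ this] r show False by simp
qed

lemma A_contraction_has_fixed_point:
  fixes S :: "'a::complete_space \<Rightarrow> 'a"
  assumes f: "f \<in> class_A" and S: "A_contraction_wrt f S"
  shows "\<exists>p. S p = p"
proof -
  obtain C where C: "\<And>u v. dist u v \<le> C * (dist u (S u) + dist v (S v))"
    using A_contraction_dist_le_residuals[OF f S] by blast
  define K where "K = \<bar>C\<bar> + 1"
  have K: "K > 0" "C \<le> K" by (auto simp: K_def)
  define w where "w n = (S ^^ n) undefined" for n
  have res: "(\<lambda>n. dist (w n) (S (w n))) \<longlonglongrightarrow> 0"
    unfolding w_def by (rule A_contraction_residual_tendsto_0[OF f S])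
  have "Cauchy w"
    unfolding Cauchy_altdef2
  proof (intro allI impI)
    fix e :: real
    assume "e > 0"
    have "\<forall>\<^sub>F n in sequentially. dist (w n) (S (w n)) < e / (2 * K)"
      using res K \<open>e > 0\<close> by (intro order_tendstoD) auto
    then obtain N where N: "\<And>n. n \<ge> N \<Longrightarrow> dist (w n) (S (w n)) < e / (2 * K)"
      by (auto simp: eventually_sequentially)
    have "dist (w n) (w N) < e" if "n \<ge> N" for n
    proof -
      have "dist (w n) (w N) \<le> C * (dist (w n) (S (w n)) + dist (w N) (S (w N)))"
        by (rule C)
      also have "\<dots> \<le> K * (dist (w n) (S (w n)) + dist (w N) (S (w N)))"
        using K by (intro mult_right_mono) auto
      also have "\<dots> < K * (e / (2 * K) + e / (2 * K))"
        using N[OF that] N[of N] K by (intro mult_strict_left_mono) auto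
      also have "\<dots> = e" using K by (simp add: field_simps)
      finally show ?thesis .
    qed
    then show "\<exists>N. \<forall>n\<ge>N. dist (w n) (w N) < e" by blast
  qed
  then obtain p where "w \<longlonglongrightarrow> p"
    by (auto simp: Cauchy_convergent_iff convergent_def)
  then show ?thesis
    using A_contraction_fixed_limit[OF f S res] by blast
qed

lemma A_contraction_well_posed:
  fixes S :: "'a::complete_space \<Rightarrow> 'a"
  assumes f: "f \<in> class_A" and S: "A_contraction_wrt f S"
  shows "well_posed_fixed_point_problem S"
proof -
  obtain C where C: "\<And>u v. dist u v \<le> C * (dist u (S u) + dist v (S v))"
    using A_contraction_dist_le_residuals[OF f S] by blast
  obtain p where p: "S p = p"
    using A_contraction_has_fixed_point[OF f S] by blast
  have unique: "q = p" if "S q = q" for q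
    using C[of q p] p that by simp
  have the_p: "(THE q. S q = q) = p"
    using p unique by (rule the_equality)
  have "(\<lambda>n. dist (u n) p) \<longlonglongrightarrow> 0" if "(\<lambda>n. dist (u n) (S (u n))) \<longlonglongrightarrow> 0" for u :: "nat \<Rightarrow> 'a"
  proof -
    have "(\<lambda>n. C * dist (u n) (S (u n))) \<longlonglongrightarrow> 0"
      using that by (rule tendsto_mult_right_zero)
    from tendsto_sandwich[OF _ _ tendsto_const this] show ?thesis
      using C[of "u _" p] p by simp
  qed
  then show ?thesis
    unfolding well_posed_fixed_point_problem_def the_p using p unique by blast
qed

text \<open>
  Averaging with the identity, with weight \<open>1 / (b + 1)\<close> on \<open>T\<close>, absorbs the term \<open>b (u - v)\<close>; the
  scaling property moves the same weight inside \<open>f\<close>, where it turns the residuals of \<open>T\<close> into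
  those of the averaged map.
\<close>

lemma enriched_A_contraction_averaged:
  fixes T :: "'a::real_normed_vector \<Rightarrow> 'a"
  assumes "enriched_A_contraction T"
  obtains c f where "c > 0" "f \<in> class_A" "A_contraction_wrt f (\<lambda>u. u + c *\<^sub>R (T u - u))"
proof -
  from assms obtain b f where b: "b \<ge> 0" and f: "f \<in> class_A"
    and T: "\<And>u v. u \<noteq> v \<Longrightarrow> norm (b *\<^sub>R (u - v) + T u - T v)
      \<le> f ((b + 1) * norm (u - v)) (norm (u - T u)) (norm (v - T v))"
    unfolding enriched_A_contraction_def by blast
  define c where "c = 1 / (b + 1)"
  have c: "c > 0" and cb: "c * (b + 1) = 1"
    using b by (auto simp: c_def)
  define S where "S u = u + c *\<^sub>R (T u - u)" for u
  have residual: "dist u (S u) = c * norm (u - T u)" for u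
    using c by (simp add: S_def dist_norm norm_minus_commute)
  have "dist (S u) (S v) \<le> f (dist u v) (dist u (S u)) (dist v (S v))" if "u \<noteq> v" for u v
  proof -
    have "S u - S v = (c * (b + 1)) *\<^sub>R (u - v) + c *\<^sub>R (T u - u) - c *\<^sub>R (T v - v)"
      by (simp add: cb S_def)
    also have "\<dots> = c *\<^sub>R (b *\<^sub>R (u - v) + T u - T v)"
      by (simp add: algebra_simps)
    finally have "dist (S u) (S v) = c * norm (b *\<^sub>R (u - v) + T u - T v)"
      using c by (simp add: dist_norm)
    also have "\<dots> \<le> c * f ((b + 1) * norm (u - v)) (norm (u - T u)) (norm (v - T v))"
      using T[OF that] c by simp
    also have "\<dots> \<le> f (c * ((b + 1) * norm (u - v))) (c * norm (u - T u)) (c * norm (v - T v))"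
      using b c by (intro class_A_scale[OF f]) auto
    also have "c * ((b + 1) * norm (u - v)) = dist u v"
      by (simp add: cb dist_norm flip: mult.assoc)
    finally show ?thesis by (simp add: residual)
  qed
  then have "A_contraction_wrt f S"
    by (simp add: A_contraction_wrt_def)
  then show thesis
    using that[OF c f] by (simp add: S_def[abs_def])
qed

lemma well_posed_averaged_imp_well_posed:
  fixes T :: "'a::real_normed_vector \<Rightarrow> 'a"
  assumes c: "c > 0" and wp: "well_posed_fixed_point_problem (\<lambda>u. u + c *\<^sub>R (T u - u))"
  shows "well_posed_fixed_point_problem T"
proof -
  have fixed: "u + c *\<^sub>R (T u - u) = u \<longleftrightarrow> T u = u" for u
    using c by simp
  have residual: "dist u (u + c *\<^sub>R (T u - u)) = c * dist u (T u)" for u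
    using c by (simp add: dist_norm norm_minus_commute)
  have "(\<lambda>n. c * dist (u n) (T (u n))) \<longlonglongrightarrow> 0" if "(\<lambda>n. dist (u n) (T (u n))) \<longlonglongrightarrow> 0"
    for u :: "nat \<Rightarrow> 'a"
    using that by (rule tendsto_mult_right_zero)
  then show ?thesis
    using wp unfolding well_posed_fixed_point_problem_def fixed residual by blast
qed

theorem theorem3p15:
  fixes T :: "'a::banach \<Rightarrow> 'a"
  assumes "enriched_A_contraction T"
  shows "well_posed_fixed_point_problem T"
proof -
  obtain c f where "c > 0" "f \<in> class_A" "A_contraction_wrt f (\<lambda>u. u + c *\<^sub>R (T u - u))"
    using enriched_A_contraction_averaged[OF assms] .
  then show ?thesis
    by (blast intro: well_posed_averaged_imp_well_posed A_contraction_well_posed)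
qed

end
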